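(* Let $C\in\mathbb{S}^n$, $c\in\mathbb{R}^n$, $A\in\mathbb{R}^{\ell\times n}$, $b\in\mathbb{R}^\ell$, $I_{\rm bin}=\{1,\dots,q\}\subset\{1,\dots,n\}$ (with $0\le q\le n$, $I_{\rm bin}=\emptyset$ if $q=0$) and $I_{\rm comp}\subset\{(j,k):1\le j<k\le n\}$. Consider the quadratic optimization problem $$\zeta_{\rm QOP}=\inf\Big\{w^TCw+2c^Tw:\ w\in\mathbb{R}^n_+,\ (Aw-b)^T(Aw-b)=0,\ \sum_{(j,k)\in I_{\rm comp}}w_jw_k=0,\ w_p(1-w_p)=0\ (p=1,\dots,q)\Big\},$$ and assume that its feasible region is nonempty. Assume further that (a) $w_i\le 1$ whenever $w\in\mathbb{R}^n_+$, $Aw-b=0$ and $i\in I_{\rm bin}$; and (b) $w_j=0$ and $w_k=0$ whenever $w\in\mathbb{R}^n_+$, $Aw=0$ and $(j,k)\in I_{\rm comp}$. Then, with $\mathbb{J}$, $Q^0$ and $H^0$ as defined in the context, $\mathbb{J}$ is a face of $\mathbb{CPP}^{1+n}$ and $$\inf\{\langle Q^0,X\rangle: X\in\mathbb{J},\ \langle H^0,X\rangle=1\}=\zeta_{\rm QOP}.$$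
   Context: $\mathbb{S}^{k}$ is the space of real symmetric $k\times k$ matrices with $\langle A,B\rangle=\sum_{i,j}A_{ij}B_{ij}$. Coordinates of $\mathbb{R}^{1+n}$ are indexed by $0,\dots,n$ and $x\in\mathbb{R}^{1+n}$ is written $x=(x_0,w)$ with $w\in\mathbb{R}^n$. $\mathbb{CPP}^{1+n}$ is the convex hull of $\{xx^T:x\in\mathbb{R}^{1+n}_+\}$ (the completely positive cone). Let $m=q+2$ and define the homogeneous quadratic functions $\bar f_0(x)=w^TCw+2x_0c^Tw$, $\bar f_1(x)=(Aw-bx_0)^T(Aw-bx_0)$, $\bar f_2(x)=\sum_{(j,k)\in I_{\rm comp}}w_jw_k$, and $\bar f_p(x)=w_{p-2}(x_0-w_{p-2})$ for $p=3,\dots,m$. Let $Q^p\in\mathbb{S}^{1+n}$ be the matrix with $\bar f_p(x)=\langle Q^p,xx^T\rangle$ for all $x\in\mathbb{R}^{1+n}$ ($p=0,\dots,m$). Let $H^0\in\mathbb{S}^{1+n}$ have $(0,0)$ entry $1$ and all other entries $0$. Define $\mathbb{J}=\{X\in\mathbb{CPP}^{1+n}:\langle Q^p,X\rangle=0\ (p=1,\dots,m)\}$. Infima are extended real numbers. A convex cone $\mathbb{J}\subset\mathbb{C}$ is a face of a convex cone $\mathbb{C}$ if $X^1,X^2\in\mathbb{J}$ whenever $X^1,X^2\in\mathbb{C}$ and $X^1/2+X^2/2\in\mathbb{J}$ (the face $\mathbb{J}=\mathbb{C}$ is allowed). *)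

theory Defs
  imports "HOL-Analysis.Analysis"
begin

text \<open>
  \<open>\<real>\<^sup>n\<close> is \<open>real^'n\<close>, with the coordinates numbered \<open>1, \<dots>, n\<close> by a bijection
  \<open>idx\<close> from \<open>{1..CARD('n)}\<close> onto \<open>'n\<close>: the paper's \<open>w\<^sub>p\<close> is \<open>w $ idx p\<close>.
  \<open>\<real>\<^sup>1\<^sup>+\<^sup>n\<close> is \<open>real^('n option)\<close>, where \<open>None\<close> is the coordinate \<open>0\<close> and \<open>Some i\<close> is the
  coordinate \<open>i\<close> of the \<open>w\<close>-part.  The inner product \<open>\<bullet>\<close> on \<open>real^'k^'k\<close> is the
  entrywise (trace) inner product.
\<close>

definition tail :: "real^('n::finite option) \<Rightarrow> real^'n" where
  "tail x = (\<chi> i. x $ Some i)"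

definition nonneg :: "real^'k \<Rightarrow> bool" where
  "nonneg x \<longleftrightarrow> (\<forall>i. 0 \<le> x $ i)"

definition outer :: "real^'k \<Rightarrow> real^'k^'k" where
  "outer x = (\<chi> i j. x $ i * x $ j)"

definition CPP :: "(real^'k^'k) set" where
  "CPP = convex hull {outer x |x. nonneg x}"

text \<open>
  The library's \<open>face_of\<close> quantifies over all points of an open segment and does not ask
  for cones; the midpoint definition for convex cones is stated here.
\<close>

definition cone_face :: "'a::real_vector set \<Rightarrow> 'a set \<Rightarrow> bool" where
  "cone_face J K \<longleftrightarrow> convex_cone K \<and> convex_cone J \<and> J \<subseteq> K \<and>
     (\<forall>X1\<in>K. \<forall>X2\<in>K. (1/2) *\<^sub>R X1 + (1/2) *\<^sub>R X2 \<in> J \<longrightarrow> X1 \<in> J \<and> X2 \<in> J)"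

definition fbar ::
  "real^'n^'n \<Rightarrow> real^'n \<Rightarrow> real^'n^'l \<Rightarrow> real^'l \<Rightarrow> (nat \<Rightarrow> 'n) \<Rightarrow> (nat \<times> nat) set
    \<Rightarrow> nat \<Rightarrow> real^('n option) \<Rightarrow> real" where
  "fbar C c A b idx Icomp p x =
    (let x0 = x $ None; w = tail x in
     if p = 0 then w \<bullet> (C *v w) + 2 * x0 * (c \<bullet> w)
     else if p = 1 then (A *v w - x0 *\<^sub>R b) \<bullet> (A *v w - x0 *\<^sub>R b)
     else if p = 2 then (\<Sum>(j, k)\<in>Icomp. w $ idx j * w $ idx k)
     else w $ idx (p - 2) * (x0 - w $ idx (p - 2)))"

definition quad_matrix :: "(real^'k \<Rightarrow> real) \<Rightarrow> real^'k^'k" where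
  "quad_matrix f = (THE Q. transpose Q = Q \<and> (\<forall>x. f x = Q \<bullet> outer x))"

definition Qmat ::
  "real^'n^'n \<Rightarrow> real^'n \<Rightarrow> real^'n^'l \<Rightarrow> real^'l \<Rightarrow> (nat \<Rightarrow> 'n) \<Rightarrow> (nat \<times> nat) set
    \<Rightarrow> nat \<Rightarrow> real^('n option)^('n option)" where
  "Qmat C c A b idx Icomp p = quad_matrix (fbar C c A b idx Icomp p)"

definition H0 :: "real^('n::finite option)^('n option)" where
  "H0 = (\<chi> i j. if i = None \<and> j = None then 1 else 0)"

definition Jcone ::
  "real^'n^'n \<Rightarrow> real^'n \<Rightarrow> real^'n^'l \<Rightarrow> real^'l \<Rightarrow> (nat \<Rightarrow> 'n) \<Rightarrow> nat \<Rightarrow> (nat \<times> nat) set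
    \<Rightarrow> (real^('n option)^('n option)) set" where
  "Jcone C c A b idx q Icomp =
    {X \<in> CPP. \<forall>p\<in>{1..q + 2}. Qmat C c A b idx Icomp p \<bullet> X = 0}"

definition qop_feasible ::
  "real^'n^'l \<Rightarrow> real^'l \<Rightarrow> (nat \<Rightarrow> 'n) \<Rightarrow> nat \<Rightarrow> (nat \<times> nat) set \<Rightarrow> (real^'n) set" where
  "qop_feasible A b idx q Icomp =
    {w. nonneg w \<and> (A *v w - b) \<bullet> (A *v w - b) = 0 \<and>
        (\<Sum>(j, k)\<in>Icomp. w $ idx j * w $ idx k) = 0 \<and>
        (\<forall>p\<in>{1..q}. w $ idx p * (1 - w $ idx p) = 0)}"

definition qop_value ::
  "real^'n^'n \<Rightarrow> real^'n \<Rightarrow> real^'n^'l \<Rightarrow> real^'l \<Rightarrow> (nat \<Rightarrow> 'n) \<Rightarrow> nat \<Rightarrow> (nat \<times> nat) set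
    \<Rightarrow> ereal" where
  "qop_value C c A b idx q Icomp =
    (INF w\<in>qop_feasible A b idx q Icomp. ereal (w \<bullet> (C *v w) + 2 * (c \<bullet> w)))"

text \<open>
  The definite description in \<open>quad_matrix\<close> is well defined for every \<open>fbar\<close>.
\<close>

lemma inner_outer: "Q \<bullet> outer x = x \<bullet> (Q *v x)"
  for Q :: "real^'k^'k"
  by (simp add: inner_vec_def outer_def matrix_vector_mult_def sum_distrib_left mult_ac)

lemma symmetric_quadratic_zero:
  fixes D :: "real^'k^'k"
  assumes sym: "transpose D = D" and zero: "\<And>x. D \<bullet> outer x = 0"
  shows "D = 0"
proof -
  have 1: "x \<bullet> (D *v y) = y \<bullet> (D *v x)" for x y
    using sym by (metis dot_lmul_matrix inner_commute transpose_matrix_vector)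
  have 2: "x \<bullet> (D *v y) = 0" for x y
    using zero[of "x + y"] zero[of x] zero[of y] 1[of x y]
    by (simp add: inner_outer inner_add_left inner_add_right matrix_vector_right_distrib)
  have "D *v y = 0" for y
    using 2[of "D *v y" y] by simp
  then show ?thesis
    by (metis matrix_eq matrix_vector_mult_0)
qed

definition quadratic :: "(real^'k \<Rightarrow> real) \<Rightarrow> bool" where
  "quadratic f \<longleftrightarrow> (\<exists>Q. transpose Q = Q \<and> (\<forall>x. f x = Q \<bullet> outer x))"

lemma quadratic_ex1:
  assumes "quadratic f"
  shows "\<exists>!Q. transpose Q = Q \<and> (\<forall>x. f x = Q \<bullet> outer x)"
proof -
  have "P = Q" if "transpose P = P" "transpose Q = Q"
    "\<forall>x. f x = P \<bullet> outer x" "\<forall>x. f x = Q \<bullet> outer x" for P Q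
  proof -
    have "transpose (P - Q) = P - Q"
      using that(1,2) by (simp add: transpose_def vec_eq_iff)
    moreover have "(P - Q) \<bullet> outer x = 0" for x
      using that(3,4) by (simp add: inner_diff_left)
    ultimately show ?thesis
      using symmetric_quadratic_zero[of "P - Q"] by simp
  qed
  then show ?thesis
    using assms unfolding quadratic_def by blast
qed

lemma quadratic_zero: "quadratic (\<lambda>x. 0)"
  unfolding quadratic_def by (rule exI[of _ 0]) (simp add: transpose_def vec_eq_iff)

lemma quadratic_add:
  assumes "quadratic f" "quadratic g"
  shows "quadratic (\<lambda>x. f x + g x)"
proof -
  obtain P Q where "transpose P = P" "transpose Q = Q"
    "\<forall>x. f x = P \<bullet> outer x" "\<forall>x. g x = Q \<bullet> outer x"
    using assms unfolding quadratic_def by blast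
  then show ?thesis
    unfolding quadratic_def
    by (intro exI[of _ "P + Q"]) (simp add: inner_add_left transpose_def vec_eq_iff)
qed

lemma quadratic_sum:
  assumes "\<And>i. i \<in> I \<Longrightarrow> quadratic (f i)"
  shows "quadratic (\<lambda>x. \<Sum>i\<in>I. f i x)"
  using assms
  by (induction I rule: infinite_finite_induct) (auto intro: quadratic_zero quadratic_add)

lemma quadratic_mult:
  assumes "linear g" "linear h"
  shows "quadratic (\<lambda>x. g x * h x)"
proof -
  define u where "u = (\<chi> i. g (axis i 1))"
  define v where "v = (\<chi> i. h (axis i 1))"
  define Q where "Q = (\<chi> i j. (u $ i * v $ j + u $ j * v $ i) / 2)"
  have lin: "k x = (\<Sum>i\<in>UNIV. x $ i * k (axis i 1))" if "linear k" for k :: "real^'a \<Rightarrow> real" and x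
  proof -
    have "k x = k (\<Sum>i\<in>UNIV. x $ i *\<^sub>R axis i 1)"
      by (simp add: basis_expansion scalar_mult_eq_scaleR[symmetric])
    then show ?thesis
      using that by (simp add: linear_sum linear_cmul)
  qed
  have "g x * h x = Q \<bullet> outer x" for x
  proof -
    have *: "g x * h x = (\<Sum>i\<in>UNIV. \<Sum>j\<in>UNIV. x $ i * x $ j * (u $ i * v $ j))"
      unfolding u_def v_def
      by (subst lin[OF assms(1), of x], subst lin[OF assms(2), of x])
        (simp add: sum_product mult_ac)
    also have "\<dots> = (\<Sum>i\<in>UNIV. \<Sum>j\<in>UNIV. x $ i * x $ j * (u $ j * v $ i))"
      by (subst sum.swap) (simp add: mult_ac)
    finally have **: "g x * h x = \<dots>" .
    have "Q \<bullet> outer x = (\<Sum>i\<in>UNIV. \<Sum>j\<in>UNIV.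
        (x $ i * x $ j * (u $ i * v $ j)) / 2 + (x $ i * x $ j * (u $ j * v $ i)) / 2)"
      by (simp add: inner_vec_def Q_def outer_def field_simps)
    also have "\<dots> = g x * h x"
      using * ** by (simp add: sum.distrib sum_divide_distrib[symmetric])
    finally show ?thesis by simp
  qed
  moreover have "transpose Q = Q"
    by (simp add: Q_def transpose_def vec_eq_iff add.commute)
  ultimately show ?thesis
    unfolding quadratic_def by blast
qed

lemma quadratic_fbar: "quadratic (fbar C c A b idx Icomp p)"
proof -
  have nth: "linear (\<lambda>x::real^('a::finite option). x $ i)" for i
    by (simp add: linear_iff)
  have tail: "linear (tail :: real^('a option) \<Rightarrow> real^'a)"
    by (simp add: linear_iff tail_def vec_eq_iff)
  have row: "linear (\<lambda>x. (A *v tail x - (x $ None) *\<^sub>R b) $ r)" for r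
    using tail by (simp add: linear_iff matrix_vector_right_distrib
        matrix_vector_mult_scaleR algebra_simps)
  have Cw: "linear (\<lambda>x. (C *v tail x) $ r)" for r
    using tail by (simp add: linear_iff matrix_vector_right_distrib matrix_vector_mult_scaleR)
  have cw: "linear (\<lambda>x. 2 * (c \<bullet> tail x))"
    using tail by (simp add: linear_iff inner_add_right algebra_simps)
  have diff: "linear (\<lambda>x::real^('a::finite option). x $ None - x $ i)" for i
    by (simp add: linear_iff algebra_simps)
  have 0: "quadratic (\<lambda>x. tail x \<bullet> (C *v tail x) + x $ None * (2 * (c \<bullet> tail x)))"
    unfolding inner_vec_def[of "tail _" "C *v _"] inner_real_def
    by (intro quadratic_add quadratic_sum quadratic_mult Cw cw nth) (simp add: tail_def nth)
  have 1: "quadratic (\<lambda>x. (A *v tail x - (x $ None) *\<^sub>R b) \<bullet> (A *v tail x - (x $ None) *\<^sub>R b))"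
    unfolding inner_vec_def inner_real_def
    by (intro quadratic_sum quadratic_mult row)
  have 2: "quadratic (\<lambda>x. \<Sum>(j, k)\<in>Icomp. tail x $ idx j * tail x $ idx k)"
    unfolding case_prod_beta tail_def vec_lambda_beta
    by (intro quadratic_sum quadratic_mult nth)
  have 3: "quadratic (\<lambda>x. tail x $ idx (p - 2) * (x $ None - tail x $ idx (p - 2)))"
    unfolding tail_def vec_lambda_beta
    by (intro quadratic_mult nth diff)
  consider "p = 0" | "p = 1" | "p = 2" | "p \<noteq> 0" "p \<noteq> 1" "p \<noteq> 2"
    by blast
  then show ?thesis
    using 0 1 2 3 by cases (simp_all add: fbar_def[abs_def] Let_def mult_ac)
qed

lemma Qmat:
  shows "transpose (Qmat C c A b idx Icomp p) = Qmat C c A b idx Icomp p"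
    and "fbar C c A b idx Icomp p x = Qmat C c A b idx Icomp p \<bullet> outer x"
  using theI'[OF quadratic_ex1[OF quadratic_fbar[of C c A b idx Icomp p]]]
  unfolding Qmat_def quad_matrix_def by blast+

end

(* The functions fbar_1, then (on the zeros of fbar_1, by conditions (a), (b)) fbar_2, ..., fbar_m are
   nonnegative on the nonnegative orthant, so J arises from CPP by taking exposed faces twice and is the
   convex hull of the matrices x x^T with x nonnegative and fbar_1 x = ... = fbar_m x = 0.  Such an x with
   x_0 > 0 is a multiple of (1, w) with w feasible; one with x_0 = 0 is (0, d) with d a recession
   direction of the feasible region, so d . C d is nonnegative unless the infimum is -infinity. *)

theory Submission
  imports Defs "HOL-Real_Asymp.Real_Asymp"
begin

section \<open>The completely positive cone and exposed faces of convex hulls\<close>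

lemma outer_scaleR: "outer (s *\<^sub>R x) = s\<^sup>2 *\<^sub>R outer x"
  by (simp add: outer_def vec_eq_iff power2_eq_square)

text \<open>Scaling by \<open>s\<close> sends generators to generators, because the factor can be
  absorbed as \<open>sqrt s\<close> into the vector. Hence the convex hull is already conic;
  \<open>outer 0\<close> shows that it is nonempty.\<close>

lemma convex_cone_CPP: "convex_cone (CPP :: (real^'k^'k) set)"
proof -
  have "s *\<^sub>R X \<in> CPP" if X: "X \<in> CPP" and s: "0 \<le> s" for X :: "real^'k^'k" and s
  proof -
    have "(*\<^sub>R) s ` {outer x |x::real^'k. nonneg x} \<subseteq> {outer x |x. nonneg x}"
    proof clarify
      fix x :: "real^'k"
      assume "nonneg x"
      then have "nonneg (sqrt s *\<^sub>R x)"
        using s by (simp add: nonneg_def)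
      moreover have "s *\<^sub>R outer x = outer (sqrt s *\<^sub>R x)"
        using s by (simp add: outer_scaleR)
      ultimately show "\<exists>y. s *\<^sub>R outer x = outer y \<and> nonneg y"
        by blast
    qed
    then have "(*\<^sub>R) s ` CPP \<subseteq> (CPP :: (real^'k^'k) set)"
      unfolding CPP_def convex_hull_scaling[symmetric] by (rule hull_mono)
    then show ?thesis
      using X by blast
  qed
  moreover have "nonneg (0 :: real^'k)"
    by (simp add: nonneg_def)
  then have "outer 0 \<in> (CPP :: (real^'k^'k) set)"
    unfolding CPP_def by (intro hull_inc) blast
  moreover have "convex (CPP :: (real^'k^'k) set)"
    by (simp add: CPP_def convex_convex_hull)
  ultimately show ?thesis
    by (auto simp: convex_cone_def conic_def)
qed

lemma convex_hull_inner_nonneg: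
  assumes "\<And>x. x \<in> S \<Longrightarrow> 0 \<le> a \<bullet> x" and "X \<in> convex hull S"
  shows "0 \<le> a \<bullet> X"
proof -
  have "convex hull S \<subseteq> {x. 0 \<le> a \<bullet> x}"
    using assms(1) by (intro hull_minimal convex_halfspace_ge) auto
  then show ?thesis
    using assms(2) by blast
qed

text \<open>In a convex combination of points with nonnegative \<open>a\<close>-values, total value
  0 leaves positive weight only on points of value 0. So the face exposed by \<open>a\<close> is
  spanned by the generators lying in it.\<close>

lemma convex_hull_inner_zero:
  assumes nonneg: "\<And>x. x \<in> S \<Longrightarrow> 0 \<le> a \<bullet> x"
    and X: "X \<in> convex hull S" "a \<bullet> X = 0"
  shows "X \<in> convex hull {x \<in> S. a \<bullet> x = 0}"
proof -
  obtain T u where T: "finite T" "T \<subseteq> S" "\<forall>x\<in>T. 0 \<le> u x" "sum u T = 1"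
    and Xsum: "(\<Sum>x\<in>T. u x *\<^sub>R x) = X"
    using X(1) unfolding convex_hull_explicit by blast
  have "(\<Sum>x\<in>T. u x * (a \<bullet> x)) = 0"
    using X(2) by (simp add: Xsum[symmetric] inner_sum_right)
  then have zero: "u x * (a \<bullet> x) = 0" if "x \<in> T" for x
    using that T nonneg by (subst (asm) sum_nonneg_eq_0_iff) auto
  \<comment> \<open>The discarded points all carry weight 0, so the remaining weights still sum to 1
    and still produce \<open>X\<close>.\<close>
  define T' where "T' = {x \<in> T. a \<bullet> x = 0}"
  have T': "finite T'" "T' \<subseteq> T"
    using T(1) by (auto simp: T'_def)
  have null: "\<forall>x\<in>T - T'. u x = 0"
    using zero by (auto simp: T'_def)
  have "sum u T' = 1"
    using sum.mono_neutral_left[OF T(1) T'(2) null] T(4) by simp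
  moreover have "(\<Sum>x\<in>T'. u x *\<^sub>R x) = X"
    using sum.mono_neutral_left[OF T(1) T'(2), of "\<lambda>x. u x *\<^sub>R x"] null Xsum by auto
  moreover have "T' \<subseteq> {x \<in> S. a \<bullet> x = 0}" "\<forall>x\<in>T'. 0 \<le> u x"
    using T by (auto simp: T'_def)
  ultimately show ?thesis
    unfolding convex_hull_explicit using T'(1) by blast
qed

section \<open>Homogenization of the feasible region\<close>

definition lift :: "real^'n \<Rightarrow> real^('n option)" where
  "lift w = (\<chi> i. case i of None \<Rightarrow> 1 | Some j \<Rightarrow> w $ j)"

lemma lift_None [simp]: "lift w $ None = 1"
  and tail_lift [simp]: "tail (lift w) = w"
  by (simp_all add: lift_def tail_def vec_eq_iff)

lemma nonneg_iff_tail: "nonneg x \<longleftrightarrow> 0 \<le> x $ None \<and> nonneg (tail x)"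
  by (auto simp: nonneg_def tail_def) (metis option.exhaust)

lemma eq_scaleR_lift:
  assumes "x $ None \<noteq> 0"
  shows "x = x $ None *\<^sub>R lift ((1 / x $ None) *\<^sub>R tail x)"
  using assms by (auto simp: vec_eq_iff lift_def tail_def split: option.split)

text \<open>The matrix representation gives homogeneity of degree two for all \<open>p\<close> at
  once, with no case distinction.\<close>

lemma fbar_scaleR: "fbar C c A b idx Icomp p (s *\<^sub>R x) = s\<^sup>2 * fbar C c A b idx Icomp p x"
  by (simp add: Qmat(2) outer_scaleR)

lemma H0_inner: "H0 \<bullet> X = X $ None $ None"
proof -
  have "H0 \<bullet> X = (\<Sum>i\<in>UNIV. \<Sum>j\<in>UNIV. if i = None \<and> j = None then X $ i $ j else 0)"
    by (auto simp: H0_def inner_vec_def intro!: sum.cong)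
  also have "\<dots> = (\<Sum>i\<in>UNIV. if i = None then X $ i $ None else 0)"
    by (intro sum.cong) auto
  finally show ?thesis
    by simp
qed

lemma H0_outer: "H0 \<bullet> outer x = (x $ None)\<^sup>2"
  by (simp add: H0_inner outer_def power2_eq_square)

text \<open>The split follows the numbering in \<open>fbar\<close>: 1 is the linear system, 2 the
  complementarity sum, and \<open>i + 2\<close> the binary constraint of variable
  \<open>i\<close>.\<close>

lemma all_constraints_iff:
  "(\<forall>p\<in>{1..q + 2}. P p) \<longleftrightarrow> P 1 \<and> P 2 \<and> (\<forall>i\<in>{1..q}. P (i + 2))" for P :: "nat \<Rightarrow> bool"
proof (intro iffI ballI)
  fix p
  assume P: "P 1 \<and> P 2 \<and> (\<forall>i\<in>{1..q}. P (i + 2))" and p: "p \<in> {1..q + 2}"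
  then consider "p = 1" | "p = 2" | "p - 2 \<in> {1..q}" "p = (p - 2) + 2"
    by force
  then show "P p"
    using P by cases metis+
qed auto

lemma qop_feasible_iff_lift:
  "w \<in> qop_feasible A b idx q Icomp \<longleftrightarrow>
     nonneg w \<and> (\<forall>p\<in>{1..q + 2}. fbar C c A b idx Icomp p (lift w) = 0)"
  unfolding all_constraints_iff by (simp add: qop_feasible_def fbar_def)

section \<open>Signs of the constraint functions on the nonnegative orthant\<close>

lemma fbar_1_nonneg: "0 \<le> fbar C c A b idx Icomp 1 x"
  by (simp add: fbar_def Let_def)

lemma fbar_1_eq_0_iff: "fbar C c A b idx Icomp 1 x = 0 \<longleftrightarrow> A *v tail x = x $ None *\<^sub>R b"
  by (simp add: fbar_def Let_def)

text \<open>The ray from \<open>w\<close> in direction \<open>d\<close> stays in the polyhedron of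
  the nonnegative solutions of the linear system. A coordinate bounded there cannot grow along the
  ray.\<close>

lemma recession_bin_zero:
  fixes A :: "real^'n^'l"
  assumes bound: "\<And>w. nonneg w \<Longrightarrow> A *v w = b \<Longrightarrow> w $ i \<le> 1"
    and w: "nonneg w" "A *v w = b" and d: "nonneg d" "A *v d = 0"
  shows "d $ i = 0"
proof (rule ccontr)
  assume "d $ i \<noteq> 0"
  with d(1) have pos: "0 < d $ i"
    by (simp add: nonneg_def order_less_le)
  \<comment> \<open>Chosen so that coordinate \<open>i\<close> grows by 2, past the bound 1 from any
    nonnegative start.\<close>
  define t where "t = 2 / d $ i"
  have "nonneg (w + t *\<^sub>R d)"
    using w d pos by (simp add: nonneg_def t_def)
  moreover have "A *v (w + t *\<^sub>R d) = b"
    using w d by (simp add: matrix_vector_right_distrib matrix_vector_mult_scaleR)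
  ultimately have "w $ i + t * d $ i \<le> 1"
    using bound by fastforce
  moreover have "t * d $ i = 2" "0 \<le> w $ i"
    using pos w(1) by (simp_all add: t_def nonneg_def)
  ultimately show False
    by simp
qed

text \<open>Only the binary functions can be negative on the orthant, and they are not once each
  binary coordinate is at most \<open>x $ None\<close>. If \<open>x $ None\<close> is positive, that
  is condition (a) after rescaling; if it is 0, \<open>tail x\<close> is a recession direction and
  its binary coordinates vanish.\<close>

lemma fbar_nonneg:
  assumes w: "nonneg w" "A *v w = b"
    and bound: "\<And>w i. nonneg w \<Longrightarrow> A *v w = b \<Longrightarrow> i \<in> {1..q} \<Longrightarrow> w $ idx i \<le> 1"
    and x: "nonneg x" "fbar C c A b idx Icomp 1 x = 0"
    and p: "p \<in> {1..q + 2}"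
  shows "0 \<le> fbar C c A b idx Icomp p x"
proof -
  have Ax: "A *v tail x = x $ None *\<^sub>R b"
    using x(2) by (simp only: fbar_1_eq_0_iff)
  have x0: "0 \<le> x $ None" and tl: "nonneg (tail x)"
    using x(1) by (auto simp: nonneg_iff_tail)
  have le: "tail x $ idx i \<le> x $ None" if i: "i \<in> {1..q}" for i
  proof (cases "x $ None = 0")
    case True
    with Ax have "A *v tail x = 0"
      by simp
    then show ?thesis
      using recession_bin_zero[of A b "idx i" w "tail x"] bound w tl i True by auto
  next
    case False
    define v where "v = (1 / x $ None) *\<^sub>R tail x"
    have "nonneg v" "A *v v = b"
      using False x0 tl Ax by (simp_all add: v_def nonneg_def matrix_vector_mult_scaleR)
    then have "v $ idx i \<le> 1"
      using bound i by blast
    then show ?thesis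
      using False x0 by (simp add: v_def divide_le_eq)
  qed
  have "\<forall>p\<in>{1..q + 2}. 0 \<le> fbar C c A b idx Icomp p x"
    unfolding all_constraints_iff
  proof (intro conjI ballI)
    show "0 \<le> fbar C c A b idx Icomp 1 x"
      by (rule fbar_1_nonneg)
    show "0 \<le> fbar C c A b idx Icomp 2 x"
      using tl by (auto simp: fbar_def Let_def nonneg_def intro!: sum_nonneg)
    show "0 \<le> fbar C c A b idx Icomp (i + 2) x" if "i \<in> {1..q}" for i
      using that le[OF that] tl by (simp add: fbar_def Let_def nonneg_def)
  qed
  then show ?thesis
    using p by blast
qed

section \<open>Faces of the completely positive cone cut out in two stages\<close>

text \<open>The signs in \<open>others\<close> are known only where \<open>Q 1\<close> vanishes, so
  \<open>Q 1\<close> is treated first: its zero set in \<open>CPP\<close> is spanned by generators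
  on which every other \<open>Q p\<close> is nonnegative. The inclusion in the second claim is the
  direction that carries lower bounds from generators to the whole set.\<close>

lemma cone_face_zero_set:
  fixes Q :: "nat \<Rightarrow> real^'k^'k"
  assumes first: "\<And>x. nonneg x \<Longrightarrow> 0 \<le> Q 1 \<bullet> outer x"
    and others: "\<And>x p. nonneg x \<Longrightarrow> Q 1 \<bullet> outer x = 0 \<Longrightarrow> p \<in> {1..m} \<Longrightarrow> 0 \<le> Q p \<bullet> outer x"
    and m: "1 \<le> m"
  shows "cone_face {X \<in> CPP. \<forall>p\<in>{1..m}. Q p \<bullet> X = 0} CPP"
    and "{X \<in> CPP. \<forall>p\<in>{1..m}. Q p \<bullet> X = 0}
           \<subseteq> convex hull {outer x |x. nonneg x \<and> (\<forall>p\<in>{1..m}. Q p \<bullet> outer x = 0)}"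
proof -
  let ?S = "{outer x |x::real^'k. nonneg x}"
  let ?S1 = "{X \<in> ?S. Q 1 \<bullet> X = 0}"
  let ?J = "{X \<in> CPP. \<forall>p\<in>{1..m}. Q p \<bullet> X = 0}"
  have ge1: "0 \<le> Q 1 \<bullet> X" if "X \<in> CPP" for X
    using that first unfolding CPP_def by - (rule convex_hull_inner_nonneg[of ?S], auto)
  have hull1: "X \<in> convex hull ?S1" if "X \<in> CPP" "Q 1 \<bullet> X = 0" for X
    using that first unfolding CPP_def by (intro convex_hull_inner_zero) auto
  have ge: "0 \<le> Q p \<bullet> X" if "X \<in> CPP" "Q 1 \<bullet> X = 0" "p \<in> {1..m}" for X p
    using hull1[OF that(1,2)] others that(3) by - (rule convex_hull_inner_nonneg[of ?S1], auto)
  show "cone_face ?J CPP"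
    unfolding cone_face_def
  proof (intro conjI ballI impI)
    show "convex_cone (CPP :: (real^'k^'k) set)"
      by (rule convex_cone_CPP)
    then have "0 \<in> ?J" "convex_cone (CPP :: (real^'k^'k) set)"
      using convex_cone_contains_0 by auto
    then show "convex_cone ?J"
      by (auto simp: convex_cone_def conic_def convex_def inner_add_right)
    show "?J \<subseteq> CPP"
      by blast
    fix X1 X2
    assume X: "X1 \<in> CPP" "X2 \<in> CPP" and mid: "(1/2) *\<^sub>R X1 + (1/2) *\<^sub>R X2 \<in> ?J"
    have sum0: "Q p \<bullet> X1 + Q p \<bullet> X2 = 0" if "p \<in> {1..m}" for p
    proof -
      have "Q p \<bullet> ((1/2) *\<^sub>R X1 + (1/2) *\<^sub>R X2) = 0"
        using mid that by blast
      then show ?thesis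
        by (simp add: inner_add_right)
    qed
    \<comment> \<open>Two nonnegative numbers with sum 0 both vanish. This must be done for
      \<open>Q 1\<close> before \<open>ge\<close> becomes available for the other indices.\<close>
    have "Q 1 \<bullet> X1 = 0" "Q 1 \<bullet> X2 = 0"
      using sum0[of 1] m ge1[OF X(1)] ge1[OF X(2)] by auto
    then have "Q p \<bullet> X1 = 0 \<and> Q p \<bullet> X2 = 0" if "p \<in> {1..m}" for p
      using sum0[OF that] ge[OF X(1) _ that] ge[OF X(2) _ that] by auto
    then show "X1 \<in> ?J" "X2 \<in> ?J"
      using X by auto
  qed
  show "?J \<subseteq> convex hull {outer x |x. nonneg x \<and> (\<forall>p\<in>{1..m}. Q p \<bullet> outer x = 0)}"
  proof
    fix X
    assume X: "X \<in> ?J"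
    \<comment> \<open>One exposure by the sum replaces one for each index: on \<open>?S1\<close> all
      summands are nonnegative, so the sum vanishes exactly where all of them do.\<close>
    have "X \<in> convex hull {Y \<in> ?S1. sum Q {1..m} \<bullet> Y = 0}"
    proof (rule convex_hull_inner_zero)
      show "0 \<le> sum Q {1..m} \<bullet> Y" if "Y \<in> ?S1" for Y
        using that others by (auto simp: inner_sum_left intro!: sum_nonneg)
      show "X \<in> convex hull ?S1"
        using X m by (intro hull1) auto
      show "sum Q {1..m} \<bullet> X = 0"
        using X by (simp add: inner_sum_left)
    qed
    moreover have "{Y \<in> ?S1. sum Q {1..m} \<bullet> Y = 0}
        \<subseteq> {outer x |x. nonneg x \<and> (\<forall>p\<in>{1..m}. Q p \<bullet> outer x = 0)}"
    proof clarify
      fix x :: "real^'k"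
      assume x: "nonneg x" "Q 1 \<bullet> outer x = 0" "sum Q {1..m} \<bullet> outer x = 0"
      then have "\<forall>p\<in>{1..m}. Q p \<bullet> outer x = 0"
        using others by (subst (asm) inner_sum_left, subst (asm) sum_nonneg_eq_0_iff) auto
      then show "\<exists>y. outer x = outer y \<and> nonneg y \<and> (\<forall>p\<in>{1..m}. Q p \<bullet> outer y = 0)"
        using x by blast
    qed
    ultimately show "X \<in> convex hull {outer x |x. nonneg x \<and> (\<forall>p\<in>{1..m}. Q p \<bullet> outer x = 0)}"
      using hull_mono by blast
  qed
qed

section \<open>Lower bound for the objective on the generators\<close>

text \<open>With negative \<open>\<alpha>\<close> the square term dominates, whatever the sign of
  \<open>\<beta>\<close>, and the polynomial drops below \<open>r\<close> at some nonnegative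
  \<open>t\<close>.\<close>

lemma quadratic_bounded_below_leading_coeff:
  fixes \<alpha> \<beta> \<gamma> r :: real
  assumes "\<And>t. 0 \<le> t \<Longrightarrow> r \<le> \<gamma> + t * \<beta> + t\<^sup>2 * \<alpha>"
  shows "0 \<le> \<alpha>"
proof (rule ccontr)
  assume "\<not> 0 \<le> \<alpha>"
  then have "filterlim (\<lambda>t. \<gamma> + t * \<beta> + t\<^sup>2 * \<alpha>) at_bot at_top"
    by real_asymp
  then have "\<forall>\<^sub>F t in at_top. \<gamma> + t * \<beta> + t\<^sup>2 * \<alpha> < r"
    by (simp add: filterlim_at_bot_dense)
  then have "\<forall>\<^sub>F t in at_top. \<gamma> + t * \<beta> + t\<^sup>2 * \<alpha> < r \<and> 0 \<le> t"
    using eventually_ge_at_top eventually_conj by blast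
  then obtain t where "\<gamma> + t * \<beta> + t\<^sup>2 * \<alpha> < r" "0 \<le> t"
    using eventually_happens' trivial_limit_at_top_linorder by blast
  with assms show False
    by (meson not_less)
qed

text \<open>This is the homogeneous form of "\<open>r\<close> is a lower bound of the objective". It
  holds by rescaling to a feasible point if \<open>x $ None\<close> is nonzero. Otherwise it says
  that the quadratic part is nonnegative along a recession direction, as boundedness along a
  feasible ray forces.\<close>

lemma fbar_0_lower_bound:
  assumes w: "w \<in> qop_feasible A b idx q Icomp"
    and bound: "\<And>w i. nonneg w \<Longrightarrow> A *v w = b \<Longrightarrow> i \<in> {1..q} \<Longrightarrow> w $ idx i \<le> 1"
    and comp: "\<And>w j k. nonneg w \<Longrightarrow> A *v w = 0 \<Longrightarrow> (j, k) \<in> Icomp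
                 \<Longrightarrow> w $ idx j = 0 \<and> w $ idx k = 0"
    and r: "\<And>w. w \<in> qop_feasible A b idx q Icomp \<Longrightarrow> r \<le> w \<bullet> (C *v w) + 2 * (c \<bullet> w)"
    and x: "nonneg x" "\<forall>p\<in>{1..q + 2}. fbar C c A b idx Icomp p x = 0"
  shows "r * (x $ None)\<^sup>2 \<le> fbar C c A b idx Icomp 0 x"
proof (cases "x $ None = 0")
  case False
  define v where "v = (1 / x $ None) *\<^sub>R tail x"
  have xv: "x = x $ None *\<^sub>R lift v"
    unfolding v_def using False by (rule eq_scaleR_lift)
  have fx: "fbar C c A b idx Icomp p x = (x $ None)\<^sup>2 * fbar C c A b idx Icomp p (lift v)" for p
    by (subst xv) (rule fbar_scaleR)
  have "nonneg v"
    using x(1) by (simp add: v_def nonneg_def tail_def)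
  then have "v \<in> qop_feasible A b idx q Icomp"
    using x(2) False by (simp add: fx qop_feasible_iff_lift[of v A b idx q Icomp C c])
  then have "r \<le> fbar C c A b idx Icomp 0 (lift v)"
    using r by (simp add: fbar_def)
  then show ?thesis
    by (subst fx, subst mult.commute) (intro mult_left_mono zero_le_power2)
next
  case True
  define d where "d = tail x"
  have d: "nonneg d"
    using x(1) by (simp add: d_def nonneg_iff_tail[of x])
  have "fbar C c A b idx Icomp 1 x = 0"
    using x(2) by auto
  then have Ad: "A *v d = 0"
    unfolding fbar_1_eq_0_iff by (simp add: d_def True)
  have w': "nonneg w" "A *v w = b"
    using w by (simp_all add: qop_feasible_def)
  have bin0: "d $ idx i = 0" if "i \<in> {1..q}" for i
    using recession_bin_zero[OF _ w' d Ad] bound that by blast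
  have comp0: "d $ idx j = 0" "d $ idx k = 0" if "(j, k) \<in> Icomp" for j k
    using comp[OF d Ad that] by auto
  \<comment> \<open>Along the ray the binary and complementary coordinates keep the values they have
    in \<open>w\<close>, by conditions (a) and (b), so the nonlinear constraints persist.\<close>
  have feas: "w + t *\<^sub>R d \<in> qop_feasible A b idx q Icomp" if "0 \<le> t" for t
  proof -
    have "nonneg (w + t *\<^sub>R d)"
      using w' d that by (simp add: nonneg_def)
    moreover have "A *v (w + t *\<^sub>R d) = b"
      using w' Ad by (simp add: matrix_vector_right_distrib matrix_vector_mult_scaleR)
    moreover have "(\<Sum>(j, k)\<in>Icomp. (w + t *\<^sub>R d) $ idx j * (w + t *\<^sub>R d) $ idx k)
        = (\<Sum>(j, k)\<in>Icomp. w $ idx j * w $ idx k)"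
      by (intro sum.cong) (auto simp: comp0)
    ultimately show ?thesis
      using w bin0 by (simp add: qop_feasible_def)
  qed
  \<comment> \<open>The objective along the ray, sorted by powers of \<open>t\<close>; both mixed
    terms go into the linear coefficient.\<close>
  have "r \<le> (w \<bullet> (C *v w) + 2 * (c \<bullet> w))
      + t * (w \<bullet> (C *v d) + d \<bullet> (C *v w) + 2 * (c \<bullet> d)) + t\<^sup>2 * (d \<bullet> (C *v d))" if "0 \<le> t" for t
    using r[OF feas[OF that]]
    by (simp add: matrix_vector_right_distrib matrix_vector_mult_scaleR inner_add_left
        inner_add_right algebra_simps power2_eq_square)
  then have "0 \<le> d \<bullet> (C *v d)"
    by (rule quadratic_bounded_below_leading_coeff)
  then show ?thesis
    using True by (simp add: fbar_def Let_def d_def)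
qed

section \<open>The face property and the equality of the two infima\<close>

theorem mainTheorem5:
  fixes C :: "real^'n^'n" and c :: "real^'n"
    and A :: "real^'n^'l" and b :: "real^'l"
    and idx :: "nat \<Rightarrow> 'n" and q :: nat and Icomp :: "(nat \<times> nat) set"
  assumes idx: "bij_betw idx {1..CARD('n)} UNIV"
    and C_sym: "transpose C = C"
    and q_le: "q \<le> CARD('n)"
    and Icomp: "Icomp \<subseteq> {(j, k). 1 \<le> j \<and> j < k \<and> k \<le> CARD('n)}"
    and feasible: "qop_feasible A b idx q Icomp \<noteq> {}"
    and cond_a: "\<forall>w. nonneg w \<and> A *v w - b = 0 \<longrightarrow> (\<forall>i\<in>{1..q}. w $ idx i \<le> 1)"
    and cond_b: "\<forall>w. nonneg w \<and> A *v w = 0 \<longrightarrow>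
                   (\<forall>(j, k)\<in>Icomp. w $ idx j = 0 \<and> w $ idx k = 0)"
  shows "cone_face (Jcone C c A b idx q Icomp) CPP \<and>
         (INF X\<in>{X \<in> Jcone C c A b idx q Icomp. H0 \<bullet> X = 1}.
            ereal (Qmat C c A b idx Icomp 0 \<bullet> X))
         = qop_value C c A b idx q Icomp"
proof -
  let ?f = "fbar C c A b idx Icomp" and ?Q = "Qmat C c A b idx Icomp"
  let ?F = "qop_feasible A b idx q Icomp" and ?J = "Jcone C c A b idx q Icomp"
  let ?G = "{outer x |x. nonneg x \<and> (\<forall>p\<in>{1..q + 2}. ?Q p \<bullet> outer x = 0)}"
  obtain w0 where w0: "w0 \<in> ?F"
    using feasible by blast
  then have w0': "nonneg w0" "A *v w0 = b"
    by (simp_all add: qop_feasible_def)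
  have bound: "w $ idx i \<le> 1" if "nonneg w" "A *v w = b" "i \<in> {1..q}" for w i
    using cond_a that by auto
  have comp: "w $ idx j = 0 \<and> w $ idx k = 0"
    if "nonneg w" "A *v w = 0" "(j, k) \<in> Icomp" for w j k
    using cond_b that by blast
  have first: "0 \<le> ?Q 1 \<bullet> outer x" for x
    unfolding Qmat(2)[symmetric] by (rule fbar_1_nonneg)
  have others: "0 \<le> ?Q p \<bullet> outer x"
    if "nonneg x" "?Q 1 \<bullet> outer x = 0" "p \<in> {1..q + 2}" for x p
    using that unfolding Qmat(2)[symmetric] by (intro fbar_nonneg[OF w0' bound])
  have face: "cone_face ?J CPP" and J_hull: "?J \<subseteq> convex hull ?G"
    using cone_face_zero_set[of ?Q "q + 2", OF first others] unfolding Jcone_def by auto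
  have "(INF X\<in>{X \<in> ?J. H0 \<bullet> X = 1}. ereal (?Q 0 \<bullet> X)) = qop_value C c A b idx q Icomp"
  proof (rule antisym)
    \<comment> \<open>Each feasible \<open>w\<close> yields the rank-one matrix
      \<open>outer (lift w)\<close> in the slice, with the same objective value.\<close>
    show "(INF X\<in>{X \<in> ?J. H0 \<bullet> X = 1}. ereal (?Q 0 \<bullet> X)) \<le> qop_value C c A b idx q Icomp"
      unfolding qop_value_def
    proof (rule INF_mono)
      fix w
      assume "w \<in> ?F"
      then have w: "nonneg w" "\<forall>p\<in>{1..q + 2}. ?f p (lift w) = 0"
        using qop_feasible_iff_lift[of w A b idx q Icomp C c] by auto
      then have "nonneg (lift w)"
        by (simp add: nonneg_iff_tail[of "lift w"])
      then have "outer (lift w) \<in> ?J"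
        using w(2) by (auto simp: Jcone_def CPP_def Qmat(2)[symmetric] intro!: hull_inc)
      moreover have "H0 \<bullet> outer (lift w) = 1"
        by (simp add: H0_outer)
      moreover have "?Q 0 \<bullet> outer (lift w) = w \<bullet> (C *v w) + 2 * (c \<bullet> w)"
        by (simp add: Qmat(2)[symmetric] fbar_def)
      ultimately show "\<exists>X\<in>{X \<in> ?J. H0 \<bullet> X = 1}.
          ereal (?Q 0 \<bullet> X) \<le> ereal (w \<bullet> (C *v w) + 2 * (c \<bullet> w))"
        by (intro bexI[of _ "outer (lift w)"]) auto
    qed
    show "qop_value C c A b idx q Icomp \<le> (INF X\<in>{X \<in> ?J. H0 \<bullet> X = 1}. ereal (?Q 0 \<bullet> X))"
    proof (rule INF_greatest)
      fix X
      assume "X \<in> {X \<in> ?J. H0 \<bullet> X = 1}"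
      then have X: "X \<in> convex hull ?G" "H0 \<bullet> X = 1"
        using J_hull by auto
      have le: "qop_value C c A b idx q Icomp \<le> ereal (w \<bullet> (C *v w) + 2 * (c \<bullet> w))"
        if "w \<in> ?F" for w
        unfolding qop_value_def using that by (rule INF_lower)
      show "qop_value C c A b idx q Icomp \<le> ereal (?Q 0 \<bullet> X)"
      \<comment> \<open>The value \<open>-\<infinity>\<close> is trivially a lower bound, and
        \<open>\<infinity>\<close> is excluded by the feasible point \<open>w0\<close>.\<close>
      proof (cases "qop_value C c A b idx q Icomp")
        case (real r)
        then have r: "r \<le> w \<bullet> (C *v w) + 2 * (c \<bullet> w)" if "w \<in> ?F" for w
          using le[OF that] by simp
        \<comment> \<open>Subtracting \<open>r *\<^sub>R H0\<close> turns the bound into a linear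
          inequality that can be checked on generators; on the slice
          \<open>H0 \<bullet> X = 1\<close> it reads
          \<open>r \<le> ?Q 0 \<bullet> X\<close>.\<close>
        have "0 \<le> (?Q 0 - r *\<^sub>R H0) \<bullet> Y" if "Y \<in> ?G" for Y
        proof -
          obtain x where x: "Y = outer x" "nonneg x" "\<forall>p\<in>{1..q + 2}. ?f p x = 0"
            using \<open>Y \<in> ?G\<close> unfolding Qmat(2)[symmetric] by blast
          have "r * (x $ None)\<^sup>2 \<le> ?f 0 x"
            by (rule fbar_0_lower_bound[OF w0 bound comp r x(2,3)])
          then show ?thesis
            by (simp add: x(1) inner_diff_left H0_outer Qmat(2))
        qed
        then have "0 \<le> (?Q 0 - r *\<^sub>R H0) \<bullet> X"
          using X(1) by (rule convex_hull_inner_nonneg)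
        then show ?thesis
          using X(2) real by (simp add: inner_diff_left)
      next
        case PInf
        then show ?thesis
          using le[OF w0] by simp
      qed simp
    qed
  qed
  then show ?thesis
    using face by blast
qed

end
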